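(* Let $N\ge2$ and $\gamma>0$. The image $f(\mathcal{V})$ of the vertex set $\mathcal{V}$ under the map $f$ consists of $2^N-2$ distinct vectors. Up to scaling, these vectors are the vertices of the Voronoi cell (around the origin) of the root lattice $\Lambda=\{x\in\mathbb{Z}^N:\sum_i x_i=0\}$. Equivalently, the scaled Voronoi cell whose vertex set is $\gamma f(\mathcal{V})$ is the orthogonal projection of the cube $\left[-\frac{\gamma N}{2},\frac{\gamma N}{2}\right]^N$ onto the $(N-1)$-dimensional hyperplane of $\mathbb{R}^N$ through the origin normal to $\mathbf 1=(1,\dots,1)$.
   Context: The map $f:\mathbb{T}^N\to\mathbb{R}^N$ is $f_i(\theta)=\sum_{j=1}^N\sin(\theta_j-\theta_i)$. The set $\mathcal{V}$ is $\{0,\pi/2\}^N\setminus\{(0,\dots,0),(\pi/2,\dots,\pi/2)\}$. The Voronoi cell of the lattice $\Lambda$ around the origin is the set of points of the hyperplane $\{x\in\mathbb{R}^N:\sum_i x_i=0\}$ that are at least as close to the origin as to any other point of $\Lambda$. *)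

theory Defs
  imports "HOL-Analysis.Analysis" "HOL-Library.Real_Mod"
begin

text \<open>
  The circle is the additive group of the reals modulo \<open>2\<pi>\<close>, and the torus is \<open>angle ^ 'n\<close>,
  with \<open>N = CARD('n)\<close>.
\<close>

quotient_type angle = real / "\<lambda>x y. [x = y] (rmod (2 * pi))"
  by (intro equivpI reflpI sympI transpI) (auto simp: rcong_def)

instantiation angle :: ab_group_add
begin

lift_definition zero_angle :: angle is 0 .

lift_definition plus_angle :: "angle \<Rightarrow> angle \<Rightarrow> angle" is "(+)"
  by (rule rcong_add)

lift_definition uminus_angle :: "angle \<Rightarrow> angle" is uminus
  by (rule rcong_uminus)

lift_definition minus_angle :: "angle \<Rightarrow> angle \<Rightarrow> angle" is "(-)"
  by (rule rcong_diff)

instance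
  by standard (transfer; simp add: algebra_simps)+

end

lift_definition angle_of :: "real \<Rightarrow> angle" is "\<lambda>x. x" .

lift_definition angle_sin :: "angle \<Rightarrow> real" is sin
  by (rule sin_rcong)

definition sine_coupling :: "angle ^ 'n::finite \<Rightarrow> real ^ 'n" where
  "sine_coupling \<theta> = (\<chi> i. \<Sum>j\<in>UNIV. angle_sin (\<theta> $ j - \<theta> $ i))"

definition vertex_set :: "(angle ^ 'n::finite) set" where
  "vertex_set = {\<theta>. \<forall>i. \<theta> $ i \<in> {angle_of 0, angle_of (pi / 2)}}
     - {\<chi> i. angle_of 0, \<chi> i. angle_of (pi / 2)}"

definition root_lattice :: "(real ^ 'n::finite) set" where
  "root_lattice = {x. (\<forall>i. x $ i \<in> \<int>) \<and> (\<Sum>i\<in>UNIV. x $ i) = 0}"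

definition voronoi_cell :: "(real ^ 'n::finite) set \<Rightarrow> (real ^ 'n) set" where
  "voronoi_cell L = {x. (\<Sum>i\<in>UNIV. x $ i) = 0 \<and> (\<forall>l\<in>L. dist x 0 \<le> dist x l)}"

definition vertices :: "'a::real_vector set \<Rightarrow> 'a set" where
  "vertices P = {v. v extreme_point_of P}"

text \<open>Meaningful when \<open>S\<close> is a subspace of a Euclidean space.\<close>

definition orth_proj :: "'a::real_inner set \<Rightarrow> 'a \<Rightarrow> 'a" where
  "orth_proj S x = (THE y. y \<in> S \<and> (\<forall>s\<in>S. orthogonal (x - y) s))"

lemma orth_proj_eqI:
  assumes "subspace S" "y \<in> S" "\<And>s. s \<in> S \<Longrightarrow> orthogonal (x - y) s"
  shows "orth_proj S x = y"
  unfolding orth_proj_def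
proof (rule the_equality)
  fix z assume z: "z \<in> S \<and> (\<forall>s\<in>S. orthogonal (x - z) s)"
  then have "z - y \<in> S" using assms(1,2) by (simp add: subspace_diff)
  then have "orthogonal (x - y) (z - y)" "orthogonal (x - z) (z - y)" using z assms(3) by auto
  then have "orthogonal (z - y) (z - y)" by (simp add: orthogonal_def inner_diff_left)
  then show "z = y" by (simp add: orthogonal_def)
qed (use assms in auto)

definition ones_hyperplane :: "(real ^ 'n::finite) set" where
  "ones_hyperplane = {x. 1 \<bullet> x = 0}"

lemma dim_ones_hyperplane: "dim (ones_hyperplane :: (real ^ 'n::finite) set) = CARD('n) - 1"
  unfolding ones_hyperplane_def by (subst dim_hyperplane) auto

end

theory Submission
  imports Defs
begin

text \<open>
  The Voronoi cell and the projected cube are both described by the coordinate differences: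
  the projection of a cube of side \<open>w\<close> is the set of \<open>x\<close> with \<open>\<Sum>i. x\<^sub>i = 0\<close> and all
  \<open>x\<^sub>i - x\<^sub>j \<le> w\<close>. For \<open>w = 1\<close> this is the Voronoi cell: the roots \<open>e\<^sub>i - e\<^sub>j\<close> give these
  inequalities, and conversely a point \<open>x\<close> of it lifts to \<open>t\<close> in \<open>[-1/2, 1/2]\<^sup>N\<close>, so that
  \<open>2 x \<bullet> l = 2 t \<bullet> l \<le> \<Sum>i. \<bar>l\<^sub>i\<bar> \<le> l \<bullet> l\<close> for integral \<open>l\<close>. Its vertices are projections of vertices
  \<open>1\<^sub>S\<close> of the unit cube; the projection of \<open>1\<^sub>S\<close> is extreme for proper nonempty \<open>S\<close> because all
  inequalities \<open>x\<^sub>i - x\<^sub>j \<le> 1\<close> with \<open>i \<in> S\<close>, \<open>j \<notin> S\<close> are tight and determine the point. Finally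
  \<open>f\<close> maps the point of the torus that is \<open>0\<close> on \<open>S\<close> and \<open>\<pi>/2\<close> off \<open>S\<close> to \<open>N\<close> times the
  projection of \<open>1\<^sub>S\<close>.
\<close>

section \<open>Projection along the ones vector, and the projected cube\<close>

definition mean_free :: "real ^ 'n::finite \<Rightarrow> real ^ 'n" where
  "mean_free x = (\<chi> i. x $ i - (\<Sum>j\<in>UNIV. x $ j) / CARD('n))"

definition spread_cell :: "real \<Rightarrow> (real ^ 'n::finite) set" where
  "spread_cell w = {x. (\<Sum>i\<in>UNIV. x $ i) = 0 \<and> (\<forall>i j. x $ i - x $ j \<le> w)}"

definition proper_subsets :: "'n set set" where
  "proper_subsets = - {{}, UNIV}"

definition cell_vertex :: "'n::finite set \<Rightarrow> real ^ 'n" where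
  "cell_vertex S = mean_free (\<chi> i. indicator S i)"

lemma linear_mean_free: "linear mean_free"
  by (rule linearI)
    (auto simp: mean_free_def vec_eq_iff sum.distrib add_divide_distrib right_diff_distrib
      simp flip: sum_distrib_left)

lemma sum_mean_free [simp]: "(\<Sum>i\<in>UNIV. mean_free x $ i) = 0"
  by (simp add: mean_free_def sum_subtractf)

lemma mean_free_diff [simp]: "mean_free x $ i - mean_free x $ j = x $ i - x $ j"
  by (simp add: mean_free_def)

lemma mean_free_const [simp]: "mean_free (\<chi> i. c) = 0"
  by (simp add: mean_free_def vec_eq_iff)

text \<open>The difference \<open>x - mean_free x\<close> is a multiple of the ones vector, hence
  normal to the hyperplane.\<close>

lemma orth_proj_ones_hyperplane:
  "orth_proj ones_hyperplane = (mean_free :: real ^ 'n::finite \<Rightarrow> real ^ 'n)"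
proof
  fix x :: "real ^ 'n"
  show "orth_proj ones_hyperplane x = mean_free x"
  proof (rule orth_proj_eqI)
    show "subspace (ones_hyperplane :: (real ^ 'n) set)"
      unfolding ones_hyperplane_def by (rule subspace_hyperplane)
    show "mean_free x \<in> ones_hyperplane"
      by (simp add: ones_hyperplane_def inner_vec_def)
    show "orthogonal (x - mean_free x) s" if "s \<in> ones_hyperplane" for s
      using that
      by (simp add: ones_hyperplane_def orthogonal_def inner_vec_def mean_free_def
          flip: sum_distrib_left sum_divide_distrib)
  qed
qed

text \<open>Translating the cube along the ones vector does not change its projection, so the corner
  \<open>a\<close> is free; it is later chosen to suit each use.\<close>

lemma mean_free_image_cube:
  "mean_free ` cbox (\<chi> i. a) (\<chi> i. a + w) = (spread_cell w :: (real ^ 'n::finite) set)"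
proof (intro equalityI subsetI)
  fix x :: "real ^ 'n" assume "x \<in> mean_free ` cbox (\<chi> i. a) (\<chi> i. a + w)"
  then obtain t :: "real ^ 'n" where t: "x = mean_free t" "\<And>i. a \<le> t $ i \<and> t $ i \<le> a + w"
    by (auto simp: mem_box_cart)
  have "t $ i - t $ j \<le> w" for i j
    using t(2)[of i] t(2)[of j] by linarith
  then show "x \<in> spread_cell w"
    by (simp add: spread_cell_def t(1))
next
  fix x :: "real ^ 'n" assume x: "x \<in> spread_cell w"
  \<comment> \<open>The lift translates \<open>x\<close> so that its least coordinate becomes
    \<open>a\<close>; the bound on differences with the minimising index \<open>k\<close> keeps the
    others below \<open>a + w\<close>.\<close>
  define m where "m = Min (range (($) x))"
  have "m \<in> range (($) x)"
    unfolding m_def by (rule Min_in) auto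
  then obtain k where k: "m = x $ k" by auto
  have m: "m \<le> x $ i" for i
    unfolding m_def by (rule Min_le) auto
  define t :: "real ^ 'n" where "t = (\<chi> i. x $ i - m + a)"
  have "x $ i - m \<le> w" for i
    using x k by (simp add: spread_cell_def)
  then have "t \<in> cbox (\<chi> i. a) (\<chi> i. a + w)"
    using m by (auto simp: mem_box_cart t_def)
  moreover have "mean_free t = x"
    using x by (simp add: mean_free_def t_def vec_eq_iff sum.distrib sum_subtractf spread_cell_def
        field_simps)
  ultimately show "x \<in> mean_free ` cbox (\<chi> i. a) (\<chi> i. a + w)" by blast
qed

lemma scaleR_spread_cell:
  assumes "c > 0"
  shows "(*\<^sub>R) c ` spread_cell w = (spread_cell (c * w) :: (real ^ 'n::finite) set)"
proof (intro equalityI subsetI)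
  fix x :: "real ^ 'n" assume "x \<in> (*\<^sub>R) c ` spread_cell w"
  then show "x \<in> spread_cell (c * w)"
    using assms
    by (auto simp: spread_cell_def simp flip: sum_distrib_left right_diff_distrib)
next
  fix x :: "real ^ 'n" assume "x \<in> spread_cell (c * w)"
  then have "(1 / c) *\<^sub>R x \<in> spread_cell w"
    using assms
    by (auto simp: spread_cell_def field_simps simp flip: sum_divide_distrib)
  then show "x \<in> (*\<^sub>R) c ` spread_cell w"
    using assms by (intro image_eqI[of _ _ "(1 / c) *\<^sub>R x"]) auto
qed

section \<open>The Voronoi cell of the root lattice\<close>

lemma dist_zero_le_dist_iff:
  fixes x l :: "'a::real_inner"
  shows "dist x 0 \<le> dist x l \<longleftrightarrow> 2 * (x \<bullet> l) \<le> l \<bullet> l"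
  by (simp add: dist_norm norm_le inner_diff_left inner_diff_right inner_commute)

lemma voronoi_cell_root_lattice:
  "voronoi_cell root_lattice = (spread_cell 1 :: (real ^ 'n::finite) set)"
proof (intro equalityI subsetI)
  fix x :: "real ^ 'n" assume x: "x \<in> voronoi_cell root_lattice"
  have "x $ i - x $ j \<le> 1" for i j
  proof (cases "i = j")
    case False
    \<comment> \<open>A root has squared length 2, so its half-space is exactly the bound 1 on one
      coordinate difference.\<close>
    let ?l = "axis i 1 - axis j 1 :: real ^ 'n"
    have "?l \<in> root_lattice"
      by (auto simp: root_lattice_def axis_def sum_subtractf)
    then have "2 * (x \<bullet> ?l) \<le> ?l \<bullet> ?l"
      using x by (auto simp: voronoi_cell_def simp flip: dist_zero_le_dist_iff)
    moreover have "axis i 1 $ j = (0 :: real)" "axis j 1 $ i = (0 :: real)"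
      using False by (auto simp: axis_def)
    ultimately show ?thesis
      using False by (simp add: inner_diff_left inner_diff_right inner_axis inner_axis_axis)
  qed simp
  then show "x \<in> spread_cell 1"
    using x by (simp add: voronoi_cell_def spread_cell_def)
next
  fix x :: "real ^ 'n" assume x: "x \<in> spread_cell 1"
  then have "x \<in> mean_free ` cbox (\<chi> i. - 1 / 2) (\<chi> i. - 1 / 2 + 1)"
    by (simp only: mean_free_image_cube)
  then obtain t :: "real ^ 'n" where t: "x = mean_free t"
    and cube: "t \<in> cbox (\<chi> i. - 1 / 2) (\<chi> i. - 1 / 2 + 1)" by blast
  have t_le: "\<bar>t $ i\<bar> \<le> 1 / 2" for i
    using cube unfolding mem_box_cart by (force simp: abs_le_iff dest: spec[of _ i])
  have "2 * (x \<bullet> l) \<le> l \<bullet> l" if l: "l \<in> root_lattice" for l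
  proof -
    \<comment> \<open>\<open>x\<close> and \<open>t\<close> differ by a multiple of the ones vector,
      to which \<open>l\<close> is orthogonal.\<close>
    have "x \<bullet> l = t \<bullet> l"
      using l
      by (simp add: t mean_free_def inner_vec_def root_lattice_def left_diff_distrib sum_subtractf
          flip: sum_distrib_left sum_divide_distrib)
    moreover have "2 * (t $ i * l $ i) \<le> l $ i * l $ i" for i
    proof -
      obtain k :: int where k: "l $ i = of_int k"
        using l by (auto simp: root_lattice_def elim: Ints_cases)
      have "2 * (t $ i * l $ i) \<le> 2 * (\<bar>t $ i\<bar> * \<bar>l $ i\<bar>)"
        by (metis abs_ge_self abs_mult mult_left_mono zero_le_numeral)
      also have "\<dots> \<le> \<bar>l $ i\<bar>"
        using mult_right_mono[OF t_le[of i], of "\<bar>l $ i\<bar>"] by simp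
      \<comment> \<open>Integrality enters here: the inequality fails for reals strictly between 0
        and 1.\<close>
      also have "\<dots> \<le> l $ i * l $ i"
      proof -
        have "\<bar>k\<bar> \<le> \<bar>k\<bar> * \<bar>k\<bar>"
          using mult_right_mono[of 1 "\<bar>k\<bar>" "\<bar>k\<bar>"] by (cases "k = 0") auto
        then show ?thesis
          unfolding k by (metis abs_mult_self_eq of_int_abs of_int_le_iff of_int_mult)
      qed
      finally show ?thesis .
    qed
    ultimately show ?thesis
      by (simp add: inner_vec_def sum_distrib_left sum_mono)
  qed
  then show "x \<in> voronoi_cell root_lattice"
    using x unfolding voronoi_cell_def dist_zero_le_dist_iff spread_cell_def by auto
qed

section \<open>The vertices of the cell\<close>

lemma cell_vertex_diff [simp]:
  "cell_vertex S $ i - cell_vertex S $ j = indicator S i - indicator S j"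
  by (simp add: cell_vertex_def)

lemma cell_vertex_in_cell: "cell_vertex S \<in> spread_cell 1"
  by (auto simp: spread_cell_def) (auto simp: cell_vertex_def indicator_def)

lemma cell_vertex_Compl: "cell_vertex (- S) = - cell_vertex S"
  by (simp add: cell_vertex_def mean_free_def vec_eq_iff indicator_compl sum_subtractf
      diff_divide_distrib)

lemma cell_vertex_trivial: "S \<notin> proper_subsets \<Longrightarrow> cell_vertex S = 0"
  by (auto simp: proper_subsets_def cell_vertex_def mean_free_def vec_eq_iff)

lemma proper_subsetsE:
  assumes "S \<in> proper_subsets"
  obtains i j where "i \<in> S" "j \<notin> S"
  using assms by (auto simp: proper_subsets_def)

lemma card_proper_subsets: "card (proper_subsets :: 'n::finite set set) = 2 ^ CARD('n) - 2"
proof -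
  have "card (proper_subsets :: 'n set set) = CARD('n set) - card {{}, UNIV :: 'n set}"
    unfolding proper_subsets_def Compl_eq_Diff_UNIV by (rule card_Diff_subset) auto
  then show ?thesis by (simp add: card_UNIV_set)
qed

lemma proper_subsets_nonempty:
  assumes "CARD('n::finite) \<ge> 2"
  shows "proper_subsets \<noteq> ({} :: 'n set set)"
proof -
  have "{undefined :: 'n} \<noteq> UNIV"
    using assms by (metis card_1_singleton_iff Suc_1 not_less_eq_eq One_nat_def order_refl)
  then have "{undefined :: 'n} \<in> proper_subsets" by (simp add: proper_subsets_def)
  then show ?thesis by blast
qed

lemma inj_on_cell_vertex: "inj_on cell_vertex (proper_subsets :: 'n::finite set set)"
proof (rule inj_onI)
  fix S T :: "'n set"
  assume S: "S \<in> proper_subsets" and T: "T \<in> proper_subsets" and eq: "cell_vertex S = cell_vertex T"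
  have d: "indicator S i - indicator S j = (indicator T i - indicator T j :: real)" for i j
    using cell_vertex_diff[of S i j] cell_vertex_diff[of T i j] eq by simp
  obtain i j where ij: "i \<in> S" "j \<notin> S" using S by (rule proper_subsetsE)
  \<comment> \<open>A difference of two indicator values is 1 only as 1 - 0, so \<open>j\<close>
    lies outside both sets and serves as reference index for every \<open>k\<close>.\<close>
  then have "j \<notin> T" using d[of i j] by (cases "i \<in> T") auto
  show "S = T"
  proof (rule set_eqI)
    show "k \<in> S \<longleftrightarrow> k \<in> T" for k
      using d[of k j] ij \<open>j \<notin> T\<close> by (cases "k \<in> S"; cases "k \<in> T") auto
  qed
qed

lemma cell_vertex_unique:
  assumes S: "S \<in> proper_subsets" and x: "(\<Sum>i\<in>UNIV. x $ i) = 0"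
    and d: "\<And>i j. i \<in> S \<Longrightarrow> j \<notin> S \<Longrightarrow> x $ i - x $ j = 1"
  shows "x = cell_vertex S"
proof -
  obtain p q where pq: "p \<in> S" "q \<notin> S" using S by (rule proper_subsetsE)
  define c where "c = x $ q"
  \<comment> \<open>Coordinates in \<open>S\<close> are compared with \<open>q\<close> directly,
    those outside \<open>S\<close> by way of \<open>p\<close>.\<close>
  have "x $ i = c + indicator S i" for i
    using d[of i q] d[of p i] d[of p q] pq unfolding c_def by (cases "i \<in> S") auto
  then have x_eq: "x = (\<chi> i. indicator S i) + (\<chi> i. c)"
    by (simp add: vec_eq_iff)
  have "x = mean_free x"
    using x by (simp add: mean_free_def)
  also have "\<dots> = cell_vertex S + mean_free (\<chi> i. c)"
    by (subst x_eq) (simp only: cell_vertex_def linear_add[OF linear_mean_free])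
  finally show ?thesis by simp
qed

lemma cell_vertex_extreme:
  assumes S: "S \<in> proper_subsets"
  shows "cell_vertex S extreme_point_of spread_cell 1"
  unfolding extreme_point_of_def
proof (intro conjI ballI cell_vertex_in_cell)
  fix a b :: "real ^ 'a" assume a: "a \<in> spread_cell 1" and b: "b \<in> spread_cell 1"
  show "cell_vertex S \<notin> open_segment a b"
  proof
    assume "cell_vertex S \<in> open_segment a b"
    then obtain u where ab: "a \<noteq> b" and u: "0 < u" "u < 1"
      and eq: "cell_vertex S = (1 - u) *\<^sub>R a + u *\<^sub>R b"
      by (auto simp: in_segment)
    have *: "a $ i - a $ j = 1 \<and> b $ i - b $ j = 1" if "i \<in> S" "j \<notin> S" for i j
    proof -
      have le: "a $ i - a $ j \<le> 1" "b $ i - b $ j \<le> 1"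
        using a b by (auto simp: spread_cell_def)
      have "(1 - u) * (a $ i - a $ j) + u * (b $ i - b $ j) = 1"
        using cell_vertex_diff[of S i j] that unfolding eq by (simp add: algebra_simps)
      \<comment> \<open>Two nonnegative slacks with positive weights sum to zero, so both
        vanish.\<close>
      then have "(1 - u) * (1 - (a $ i - a $ j)) + u * (1 - (b $ i - b $ j)) = 0"
        by (simp add: algebra_simps)
      moreover have "0 \<le> (1 - u) * (1 - (a $ i - a $ j))" "0 \<le> u * (1 - (b $ i - b $ j))"
        using u le by auto
      ultimately have "(1 - u) * (1 - (a $ i - a $ j)) = 0" "u * (1 - (b $ i - b $ j)) = 0"
        by linarith+
      then show ?thesis using u by auto
    qed
    have "a = cell_vertex S" "b = cell_vertex S"
      using a b * by (auto intro!: cell_vertex_unique[OF S] simp: spread_cell_def)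
    then show False using ab by simp
  qed
qed

text \<open>The unit cube is the hull of its 0/1 points, and a linear map commutes with taking
  hulls.\<close>

lemma spread_cell_convex_hull:
  "spread_cell 1 = convex hull (range cell_vertex :: (real ^ 'n::finite) set)"
proof -
  have "{x :: real ^ 'n. \<forall>i. x $ i = 0 \<or> x $ i = 1} = range (\<lambda>S. \<chi> i. indicator S i)"
  proof (intro equalityI subsetI)
    fix x :: "real ^ 'n" assume x: "x \<in> {x. \<forall>i. x $ i = 0 \<or> x $ i = 1}"
    then have "x = (\<chi> i. indicator {i. x $ i = 1} i)"
      by (auto simp: vec_eq_iff indicator_def)
    then show "x \<in> range (\<lambda>S. \<chi> i. indicator S i)" by blast
  qed (auto simp: indicator_def)
  moreover have "(\<Sum>Basis :: real ^ 'n) = (\<chi> i. 0 + 1)" "(0 :: real ^ 'n) = (\<chi> i. 0)"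
    by (simp_all add: vec_eq_iff flip: Cart_1)
  moreover have "(\<forall>b\<in>Basis. x \<bullet> b = 0 \<or> x \<bullet> b = 1) \<longleftrightarrow> (\<forall>i. x $ i = 0 \<or> x $ i = 1)" for x :: "real ^ 'n"
    by (auto simp: Basis_vec_def inner_axis)
  ultimately have "cbox (\<chi> i. 0) (\<chi> i. 0 + 1) = convex hull (range (\<lambda>S. \<chi> i. indicator S i :: real ^ 'n))"
    using unit_interval_convex_hull[where 'a = "real ^ 'n"] by (simp only:)
  then have "spread_cell 1 = mean_free ` (convex hull (range (\<lambda>S. \<chi> i. indicator S i :: real ^ 'n)))"
    using mean_free_image_cube[of 0 1, where 'n = 'n] by simp
  then show ?thesis
    by (simp add: convex_hull_linear_image[OF linear_mean_free] image_image cell_vertex_def)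
qed

lemma vertices_spread_cell:
  assumes "CARD('n::finite) \<ge> 2"
  shows "vertices (spread_cell 1 :: (real ^ 'n) set) = cell_vertex ` proper_subsets"
proof (intro equalityI subsetI)
  fix x :: "real ^ 'n" assume "x \<in> vertices (spread_cell 1)"
  then have x: "x extreme_point_of spread_cell 1" by (simp add: vertices_def)
  then obtain S where S: "x = cell_vertex S"
    using extreme_point_of_convex_hull unfolding spread_cell_convex_hull by blast
  show "x \<in> cell_vertex ` proper_subsets"
  proof (cases "S \<in> proper_subsets")
    case False
    then have "x = 0" by (simp add: S cell_vertex_trivial)
    \<comment> \<open>The point \<open>0\<close> is not extreme: it is the midpoint of a vertex and
      its negative, which is the vertex of the complement. A proper \<open>T\<close> exists because
      the dimension is at least 2.\<close>
    obtain T :: "'n set" where T: "T \<in> proper_subsets" using proper_subsets_nonempty[OF assms] by blast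
    let ?v = "cell_vertex T"
    obtain i j where "i \<in> T" "j \<notin> T" using T by (rule proper_subsetsE)
    then have "?v $ i - ?v $ j = 1" by simp
    then have "(?v - - ?v) $ i - (?v - - ?v) $ j = 2" by (simp del: cell_vertex_diff)
    then have "?v \<noteq> - ?v" by force
    then have "0 \<in> open_segment ?v (- ?v)"
      using midpoint_in_open_segment[of ?v "- ?v"] by (simp add: midpoint_def)
    moreover have "- ?v \<in> spread_cell 1"
      using cell_vertex_in_cell[of "- T"] by (simp add: cell_vertex_Compl)
    ultimately show ?thesis
      using x cell_vertex_in_cell[of T] by (auto simp: extreme_point_of_def \<open>x = 0\<close>)
  qed (use S in blast)
qed (auto simp: vertices_def cell_vertex_extreme)

section \<open>Scaling and uniqueness of the factor\<close>

text \<open>Scaling is linear and injective, so it preserves faces, and extreme points are the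
  one-point faces.\<close>

lemma vertices_scaleR:
  assumes "c \<noteq> 0"
  shows "vertices ((*\<^sub>R) c ` P) = (*\<^sub>R) c ` vertices P"
proof -
  have "c *\<^sub>R v extreme_point_of (*\<^sub>R) c ` P \<longleftrightarrow> v extreme_point_of P" for v
    using face_of_linear_image[of "(*\<^sub>R) c" "{v}" P] assms
    by (simp add: face_of_singleton inj_on_def)
  moreover have "w \<in> (*\<^sub>R) c ` P" if "w extreme_point_of (*\<^sub>R) c ` P" for w
    using that by (simp add: extreme_point_of_def)
  ultimately show ?thesis
    unfolding vertices_def by blast
qed

text \<open>The largest coordinate difference occurring in \<open>V\<close> and \<open>W\<close> detects the scaling factor.\<close>

lemma scaleR_image_subset_imp_le:
  assumes "proper_subsets \<noteq> ({} :: 'n::finite set set)" "d > 0"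
    and V: "cell_vertex ` proper_subsets \<subseteq> V" and W: "W \<subseteq> spread_cell 1"
    and eq: "(*\<^sub>R) c ` V \<subseteq> (*\<^sub>R) d ` (W :: (real ^ 'n) set)"
  shows "c \<le> d"
proof -
  obtain S :: "'n set" where S: "S \<in> proper_subsets" using assms(1) by blast
  then obtain i j where ij: "i \<in> S" "j \<notin> S" by (rule proper_subsetsE)
  obtain y where y: "y \<in> W" "c *\<^sub>R cell_vertex S = d *\<^sub>R y" using V eq S by blast
  have "c = c * (cell_vertex S $ i - cell_vertex S $ j)" using ij by simp
  also have "\<dots> = d * (y $ i - y $ j)"
    using y(2) by (simp add: vec_eq_iff right_diff_distrib del: cell_vertex_diff)
  also have "\<dots> \<le> d"
    using y(1) W \<open>d > 0\<close> by (auto simp: spread_cell_def mult_le_cancel_left2)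
  finally show ?thesis .
qed

text \<open>Allowing any \<open>V\<close> between the vertices and the cell lets one argument serve
  both the vertex set and the whole cell.\<close>

lemma scaleR_image_eq_iff:
  assumes "proper_subsets \<noteq> ({} :: 'n::finite set set)" "c > 0" "d > 0"
    and "cell_vertex ` proper_subsets \<subseteq> V" "V \<subseteq> spread_cell 1"
  shows "(*\<^sub>R) c ` V = (*\<^sub>R) d ` (V :: (real ^ 'n) set) \<longleftrightarrow> c = d"
proof
  assume "(*\<^sub>R) c ` V = (*\<^sub>R) d ` V"
  then show "c = d"
    using scaleR_image_subset_imp_le[OF assms(1,3,4,5), of c]
      scaleR_image_subset_imp_le[OF assms(1,2,4,5), of d] by simp
qed simp

section \<open>The sine map on the vertices of the torus\<close>

lemma angle_sin_diff [simp]: "angle_sin (angle_of x - angle_of y) = sin (x - y)"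
  by transfer simp

lemma angle_of_half_pi_neq [simp]: "angle_of (pi / 2) \<noteq> angle_of 0"
proof
  assume "angle_of (pi / 2) = angle_of 0"
  then have "angle_sin (angle_of (pi / 2) - angle_of 0) = angle_sin (angle_of 0 - angle_of 0)"
    by (simp only:)
  then have "sin (pi / 2 - 0) = sin (0 - 0)" by (simp only: angle_sin_diff)
  then show False by simp
qed

text \<open>Putting \<open>0\<close> on \<open>S\<close>, rather than off it, makes the sine of the
  angle at \<open>j\<close> minus that at \<open>i\<close> equal to
  \<open>indicator S i - indicator S j\<close>, with no sign change.\<close>

definition vertex_angle :: "'n::finite set \<Rightarrow> angle ^ 'n" where
  "vertex_angle S = (\<chi> i. angle_of (if i \<in> S then 0 else pi / 2))"

lemma vertex_set_eq: "vertex_set = vertex_angle ` proper_subsets"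
proof (intro equalityI subsetI)
  fix t :: "angle ^ 'a" assume t: "t \<in> vertex_set"
  let ?S = "{i. t $ i = angle_of 0}"
  have vals: "t $ i = angle_of 0 \<or> t $ i = angle_of (pi / 2)" for i
    using t unfolding vertex_set_def by blast
  have "\<not> (\<forall>i. t $ i = angle_of 0)" "\<not> (\<forall>i. t $ i = angle_of (pi / 2))"
    using t by (auto simp: vertex_set_def vec_eq_iff simp del: not_all)
  then have "?S \<in> proper_subsets"
    using vals unfolding proper_subsets_def by blast
  moreover have "t $ i = vertex_angle ?S $ i" for i
    using vals[of i] by (cases "t $ i = angle_of 0") (simp_all add: vertex_angle_def)
  then have "t = vertex_angle ?S"
    unfolding vec_eq_iff by blast
  ultimately show "t \<in> vertex_angle ` proper_subsets" by blast
next
  fix t :: "angle ^ 'a" assume "t \<in> vertex_angle ` proper_subsets"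
  then obtain S where S: "t = vertex_angle S" "S \<in> proper_subsets" by auto
  from S(2) obtain i j where "i \<in> S" "j \<notin> S" by (rule proper_subsetsE)
  then have "t $ i = angle_of 0" "t $ j = angle_of (pi / 2)"
    by (simp_all add: S(1) vertex_angle_def)
  then have "t \<noteq> (\<chi> i. angle_of 0)" "t \<noteq> (\<chi> i. angle_of (pi / 2))"
    using angle_of_half_pi_neq by (auto simp del: angle_of_half_pi_neq)
  moreover have "t $ i \<in> {angle_of 0, angle_of (pi / 2)}" for i
    by (simp add: S(1) vertex_angle_def)
  ultimately show "t \<in> vertex_set"
    unfolding vertex_set_def by blast
qed

text \<open>Summing \<open>indicator S i - indicator S j\<close> over \<open>j\<close> gives
  \<open>N\<close> times the deviation of the indicator from its mean.\<close>

lemma sine_coupling_vertex_angle: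
  "sine_coupling (vertex_angle S) = real CARD('n::finite) *\<^sub>R (cell_vertex S :: real ^ 'n)"
proof -
  have "angle_sin (vertex_angle S $ j - vertex_angle S $ i) = indicator S i - indicator S j" for i j
    by (simp add: vertex_angle_def)
  then show ?thesis
    by (simp add: sine_coupling_def cell_vertex_def mean_free_def vec_eq_iff sum_subtractf
        right_diff_distrib)
qed

theorem proposition2p7:
  fixes \<gamma> :: real
  assumes "CARD('n::finite) \<ge> 2" and "\<gamma> > 0"
  defines "N \<equiv> CARD('n)"
  defines "fV \<equiv> sine_coupling ` (vertex_set :: (angle ^ 'n) set)"
  defines "Vor \<equiv> voronoi_cell (root_lattice :: (real ^ 'n) set)"
  defines "Q \<equiv> cbox (\<chi> i. - (\<gamma> * N / 2)) (\<chi> i. \<gamma> * N / 2) :: (real ^ 'n) set"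
  shows "card fV = 2 ^ N - 2
    \<and> (\<exists>c>0. (*\<^sub>R) c ` fV = vertices Vor)
    \<and> (\<exists>!c. c > 0 \<and> vertices ((*\<^sub>R) c ` Vor) = (*\<^sub>R) \<gamma> ` fV)
    \<and> (\<forall>c>0. vertices ((*\<^sub>R) c ` Vor) = (*\<^sub>R) \<gamma> ` fV
         \<longleftrightarrow> (*\<^sub>R) c ` Vor = orth_proj ones_hyperplane ` Q)"
proof -
  let ?V = "cell_vertex ` (proper_subsets :: 'n set set)"
  have N: "real N > 0" by (simp add: N_def)
  have ne: "proper_subsets \<noteq> ({} :: 'n set set)"
    by (rule proper_subsets_nonempty[OF assms(1)])
  have fV: "fV = (*\<^sub>R) (real N) ` ?V"
    by (simp add: fV_def vertex_set_eq image_image sine_coupling_vertex_angle N_def)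
  have Vor: "Vor = spread_cell 1"
    by (simp add: Vor_def voronoi_cell_root_lattice)
  have vert: "vertices Vor = ?V"
    by (simp add: Vor vertices_spread_cell[OF assms(1)])
  have "card fV = card (proper_subsets :: 'n set set)"
    unfolding fV using N
    by (subst card_image) (auto simp: inj_on_def card_image[OF inj_on_cell_vertex])
  also have "\<dots> = 2 ^ N - 2"
    by (simp add: card_proper_subsets N_def)
  finally have card: "card fV = 2 ^ N - 2" .
  have scale: "(*\<^sub>R) (1 / real N) ` fV = vertices Vor"
    using N by (simp add: fV vert image_image)
  \<comment> \<open>Both sides of the claimed equivalence are reduced to
    \<open>c = \<gamma> * N\<close>: the factor \<open>N\<close> comes from \<open>fV\<close> on one
    side and from the side length of the cube on the other.\<close>
  have verts_iff: "vertices ((*\<^sub>R) c ` Vor) = (*\<^sub>R) \<gamma> ` fV \<longleftrightarrow> c = \<gamma> * N" if "c > 0" for c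
  proof -
    have "(*\<^sub>R) \<gamma> ` fV = (*\<^sub>R) (\<gamma> * N) ` ?V" by (simp add: fV image_image)
    moreover have "vertices ((*\<^sub>R) c ` Vor) = (*\<^sub>R) c ` ?V"
      using that by (simp add: vertices_scaleR vert)
    ultimately show ?thesis
      using scaleR_image_eq_iff[OF ne that, of "\<gamma> * N" ?V] N \<open>\<gamma> > 0\<close> cell_vertex_in_cell
      by auto
  qed
  have "orth_proj ones_hyperplane ` Q = spread_cell (\<gamma> * N)"
    using mean_free_image_cube[of "- (\<gamma> * N / 2)" "\<gamma> * N"]
    by (simp add: Q_def orth_proj_ones_hyperplane)
  also have "\<dots> = (*\<^sub>R) (\<gamma> * N) ` Vor"
    using N \<open>\<gamma> > 0\<close> by (simp add: Vor scaleR_spread_cell)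
  finally have "(*\<^sub>R) c ` Vor = orth_proj ones_hyperplane ` Q \<longleftrightarrow> c = \<gamma> * N" if "c > 0" for c
    using scaleR_image_eq_iff[OF ne that, of "\<gamma> * N" Vor] N \<open>\<gamma> > 0\<close> cell_vertex_in_cell
    by (auto simp: Vor)
  then have "\<forall>c>0. vertices ((*\<^sub>R) c ` Vor) = (*\<^sub>R) \<gamma> ` fV
      \<longleftrightarrow> (*\<^sub>R) c ` Vor = orth_proj ones_hyperplane ` Q"
    using verts_iff by simp
  moreover have "\<exists>!c. c > 0 \<and> vertices ((*\<^sub>R) c ` Vor) = (*\<^sub>R) \<gamma> ` fV"
  proof (rule ex1I)
    show "\<gamma> * N > 0 \<and> vertices ((*\<^sub>R) (\<gamma> * N) ` Vor) = (*\<^sub>R) \<gamma> ` fV"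
      using verts_iff[of "\<gamma> * N"] N \<open>\<gamma> > 0\<close> by simp
  qed (use verts_iff in blast)
  moreover have "\<exists>c>0. (*\<^sub>R) c ` fV = vertices Vor"
    using scale N by (intro exI[of _ "1 / real N"]) simp
  ultimately show ?thesis
    using card by blast
qed

end
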